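(* (1) Let $(A,\mu)$ be a Jordan algebra over $\mathbf{k}$ and $\alpha\colon A\to A$ be an algebra morphism. Then the induced Hom-algebra $A_\alpha=(A,\mu_\alpha=\alpha\circ\mu,\alpha)$ is a Hom-Jordan algebra. (2) Let $(A,\mu,\alpha)$ be a Hom-Jordan algebra over $\mathbf{k}$. Then the derived Hom-algebra $A^n=(A,\mu^{(n)}=\alpha^{2^n-1}\circ\mu,\alpha^{2^n})$ is also a Hom-Jordan algebra for each $n\ge 0$.
   Context: $\mathbf{k}$ is a fixed field of characteristic $0$; all modules, linear maps and tensor products are over $\mathbf{k}$. An algebra $(A,\mu)$ is a $\mathbf{k}$-module with a bilinear multiplication $\mu(x,y)=xy$ (not necessarily associative or unital); an algebra morphism is a linear map $\alpha$ with $\alpha(xy)=\alpha(x)\alpha(y)$. A Jordan algebra is a commutative algebra satisfying $(x^2y)x=x^2(yx)$ for all $x,y$. A Hom-algebra is a triple $(A,\mu,\alpha)$ with $(A,\mu)$ an algebra and $\alpha\colon A\to A$ an algebra morphism of $(A,\mu)$. The Hom-associator is $as_A(x,y,z)=\mu(\mu(x,y),\alpha(z))-\mu(\alpha(x),\mu(y,z))$. A Hom-Jordan algebra is a Hom-algebra $(A,\mu,\alpha)$ with $\mu$ commutative and $as_A(\mu(x,x),\alpha(y),\alpha(x))=0$ for all $x,y\in A$. Powers $\alpha^k$ denote $k$-fold composition, $\alpha^0=\mathrm{Id}$. *)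

theory Defs
  imports Complex_Main
begin

text \<open>
  A module over the ground field is given, as in \<^theory>\<open>HOL.Vector_Spaces\<close>, by an additive group
  type together with a scalar multiplication; algebras need be neither associative nor unital.
\<close>

locale nonassoc_algebra = vector_space scale
  for scale :: "'k::field_char_0 \<Rightarrow> 'a::ab_group_add \<Rightarrow> 'a" +
  fixes mu :: "'a \<Rightarrow> 'a \<Rightarrow> 'a"
  assumes linear_mu_left: "Vector_Spaces.linear scale scale (\<lambda>x. mu x y)"
    and linear_mu_right: "Vector_Spaces.linear scale scale (\<lambda>y. mu x y)"

locale algebra_morphism =
  dom: nonassoc_algebra scale1 mu1 +
  cod: nonassoc_algebra scale2 mu2 +
  Vector_Spaces.linear scale1 scale2 f
  for scale1 :: "'k::field_char_0 \<Rightarrow> 'a::ab_group_add \<Rightarrow> 'a"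
    and mu1 :: "'a \<Rightarrow> 'a \<Rightarrow> 'a"
    and scale2 :: "'k \<Rightarrow> 'b::ab_group_add \<Rightarrow> 'b"
    and mu2 :: "'b \<Rightarrow> 'b \<Rightarrow> 'b"
    and f :: "'a \<Rightarrow> 'b" +
  assumes map_mu: "f (mu1 x y) = mu2 (f x) (f y)"

locale jordan_algebra = nonassoc_algebra +
  assumes mu_commute: "mu x y = mu y x"
    and jordan_identity: "mu (mu (mu x x) y) x = mu (mu x x) (mu y x)"

locale hom_algebra = nonassoc_algebra scale mu + algebra_morphism scale mu scale mu alpha
  for scale :: "'k::field_char_0 \<Rightarrow> 'a::ab_group_add \<Rightarrow> 'a"
    and mu :: "'a \<Rightarrow> 'a \<Rightarrow> 'a"
    and alpha :: "'a \<Rightarrow> 'a"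

definition hom_associator ::
    "('a \<Rightarrow> 'a \<Rightarrow> 'a) \<Rightarrow> ('a \<Rightarrow> 'a) \<Rightarrow> 'a \<Rightarrow> 'a \<Rightarrow> 'a \<Rightarrow> 'a::ab_group_add" where
  "hom_associator mu alpha x y z = mu (mu x y) (alpha z) - mu (alpha x) (mu y z)"

locale hom_jordan_algebra = hom_algebra +
  assumes mu_commute: "mu x y = mu y x"
    and hom_jordan_identity: "hom_associator mu alpha (mu x x) (alpha y) (alpha x) = 0"

definition induced_mult :: "('a \<Rightarrow> 'a \<Rightarrow> 'a) \<Rightarrow> ('a \<Rightarrow> 'a) \<Rightarrow> 'a \<Rightarrow> 'a \<Rightarrow> 'a" where
  "induced_mult mu alpha x y = alpha (mu x y)"

definition derived_mult :: "nat \<Rightarrow> ('a \<Rightarrow> 'a \<Rightarrow> 'a) \<Rightarrow> ('a \<Rightarrow> 'a) \<Rightarrow> 'a \<Rightarrow> 'a \<Rightarrow> 'a" where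
  "derived_mult n mu alpha x y = (alpha ^^ (2 ^ n - 1)) (mu x y)"

definition derived_twist :: "nat \<Rightarrow> ('a \<Rightarrow> 'a) \<Rightarrow> 'a \<Rightarrow> 'a" where
  "derived_twist n alpha = alpha ^^ (2 ^ n)"

end

theory Submission
  imports Defs
begin

text \<open>
  Both claims are instances of one twisting principle: a Hom-Jordan algebra
  \<open>(A, \<mu>, \<alpha>)\<close> may be twisted by any morphism \<open>\<beta>\<close> of \<open>(A, \<mu>)\<close> that commutes with \<open>\<alpha>\<close>,
  and the result \<open>(A, \<beta> \<circ> \<mu>, \<beta> \<circ> \<alpha>)\<close> is again Hom-Jordan
  (lemma \<open>hom_jordan_algebra_twist\<close>).  The reason is homogeneity: in both terms of the
  twisted Hom-Jordan identity, the number of products above an argument plus the number of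
  twists applied to it is always three.  Every argument thus sits below exactly three copies of
  \<open>\<beta>\<close>, which can be moved to the outside because \<open>\<beta>\<close> is multiplicative and commutes with
  \<open>\<alpha>\<close>.  Hence the twisted Hom-associator is \<open>\<beta>\<^sup>3\<close> of the original one, and so zero.

  A Jordan algebra is the same as a Hom-Jordan algebra with twist \<open>id\<close>, and every morphism
  commutes with \<open>id\<close>; this gives the first claim with \<open>\<beta> = \<alpha>\<close>.  Every power of \<open>\<alpha>\<close> commutes
  with \<open>\<alpha>\<close>; since \<open>\<alpha>\<^bsup>2^n - 1\<^esup> \<circ> \<alpha> = \<alpha>\<^bsup>2^n\<^esup>\<close>, this gives the second claim with
  \<open>\<beta> = \<alpha>\<^bsup>2^n - 1\<^esup>\<close>.
\<close>

lemma algebra_morphism_id: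
  assumes "nonassoc_algebra scale mu"
  shows "algebra_morphism scale mu scale mu id"
proof -
  interpret nonassoc_algebra scale mu by fact
  show ?thesis
    by (intro algebra_morphism.intro algebra_morphism_axioms.intro assms linear_id) simp
qed

lemma algebra_morphism_compose:
  assumes "algebra_morphism scale1 mu1 scale2 mu2 f"
    and "algebra_morphism scale2 mu2 scale3 mu3 g"
  shows "algebra_morphism scale1 mu1 scale3 mu3 (g \<circ> f)"
proof -
  interpret f: algebra_morphism scale1 mu1 scale2 mu2 f by fact
  interpret g: algebra_morphism scale2 mu2 scale3 mu3 g by fact
  show ?thesis
    by (intro algebra_morphism.intro algebra_morphism_axioms.intro
        f.dom.nonassoc_algebra_axioms g.cod.nonassoc_algebra_axioms
        Vector_Spaces.linear_compose[OF f.linear_axioms g.linear_axioms])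
      (simp add: f.map_mu g.map_mu)
qed

lemma algebra_morphism_funpow:
  assumes "algebra_morphism scale mu scale mu f"
  shows "algebra_morphism scale mu scale mu (f ^^ n)"
proof (induction n)
  case 0
  interpret algebra_morphism scale mu scale mu f by fact
  show ?case
    using algebra_morphism_id[OF dom.nonassoc_algebra_axioms] by (simp only: funpow.simps)
next
  case (Suc n)
  then show ?case
    using algebra_morphism_compose[OF Suc assms] by (simp only: funpow.simps)
qed

lemma nonassoc_algebra_induced_mult:
  assumes "algebra_morphism scale mu scale mu \<beta>"
  shows "nonassoc_algebra scale (induced_mult mu \<beta>)"
proof -
  interpret \<beta>: algebra_morphism scale mu scale mu \<beta> by fact
  show ?thesis
  proof (intro nonassoc_algebra.intro nonassoc_algebra_axioms.intro)
    show "vector_space scale" by (rule \<beta>.dom.vector_space_axioms)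
    show "Vector_Spaces.linear scale scale (\<lambda>x. induced_mult mu \<beta> x y)" for y
      using Vector_Spaces.linear_compose[OF \<beta>.dom.linear_mu_left \<beta>.linear_axioms]
      by (simp add: induced_mult_def o_def)
    show "Vector_Spaces.linear scale scale (\<lambda>y. induced_mult mu \<beta> x y)" for x
      using Vector_Spaces.linear_compose[OF \<beta>.dom.linear_mu_right \<beta>.linear_axioms]
      by (simp add: induced_mult_def o_def)
  qed
qed

text \<open>
  The commutation of the two morphisms enters twice: it makes \<open>\<beta> \<circ> \<alpha>\<close> multiplicative for
  \<open>\<beta> \<circ> \<mu>\<close>, and it collects the factors \<open>\<beta>\<close> separated by an \<open>\<alpha>\<close> in the arguments of the
  Hom-associator.
\<close>

lemma hom_jordan_algebra_twist:
  assumes "hom_jordan_algebra scale mu \<alpha>"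
    and \<beta>: "algebra_morphism scale mu scale mu \<beta>"
    and commute: "\<alpha> \<circ> \<beta> = \<beta> \<circ> \<alpha>"
  shows "hom_jordan_algebra scale (induced_mult mu \<beta>) (\<beta> \<circ> \<alpha>)"
proof -
  interpret A: hom_jordan_algebra scale mu \<alpha> by fact
  interpret \<beta>: algebra_morphism scale mu scale mu \<beta> by fact
  have commute': "\<alpha> (\<beta> x) = \<beta> (\<alpha> x)" for x
    using commute by (simp add: fun_eq_iff)
  have alg: "nonassoc_algebra scale (induced_mult mu \<beta>)"
    using \<beta> by (rule nonassoc_algebra_induced_mult)
  have linear: "Vector_Spaces.linear scale scale (\<beta> \<circ> \<alpha>)"
    by (rule Vector_Spaces.linear_compose[OF A.linear_axioms \<beta>.linear_axioms])
  show ?thesis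
  proof (intro hom_jordan_algebra.intro hom_algebra.intro algebra_morphism.intro
      hom_jordan_algebra_axioms.intro algebra_morphism_axioms.intro alg linear)
    show "(\<beta> \<circ> \<alpha>) (induced_mult mu \<beta> x y)
        = induced_mult mu \<beta> ((\<beta> \<circ> \<alpha>) x) ((\<beta> \<circ> \<alpha>) y)" for x y
      by (simp add: induced_mult_def A.map_mu \<beta>.map_mu commute')
    show "induced_mult mu \<beta> x y = induced_mult mu \<beta> y x" for x y
      by (simp add: induced_mult_def A.mu_commute[of x y])
    show "hom_associator (induced_mult mu \<beta>) (\<beta> \<circ> \<alpha>)
        (induced_mult mu \<beta> x x) ((\<beta> \<circ> \<alpha>) y) ((\<beta> \<circ> \<alpha>) x) = 0" for x y
    proof -
      have "hom_associator (induced_mult mu \<beta>) (\<beta> \<circ> \<alpha>)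
          (induced_mult mu \<beta> x x) ((\<beta> \<circ> \<alpha>) y) ((\<beta> \<circ> \<alpha>) x)
          = \<beta> (\<beta> (\<beta> (hom_associator mu \<alpha> (mu x x) (\<alpha> y) (\<alpha> x))))"
        by (simp add: hom_associator_def induced_mult_def A.map_mu \<beta>.map_mu \<beta>.diff commute')
      also have "\<dots> = 0"
        by (simp only: A.hom_jordan_identity \<beta>.zero)
      finally show ?thesis .
    qed
  qed
qed

lemma jordan_algebra_imp_hom_jordan_algebra_id:
  assumes "jordan_algebra scale mu"
  shows "hom_jordan_algebra scale mu id"
proof -
  interpret jordan_algebra scale mu by fact
  show ?thesis
    by (intro hom_jordan_algebra.intro hom_algebra.intro hom_jordan_algebra_axioms.intro
        algebra_morphism_id nonassoc_algebra_axioms mu_commute)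
      (simp add: hom_associator_def jordan_identity)
qed

theorem theorem5p8:
  fixes scale :: "'k::field_char_0 \<Rightarrow> 'a::ab_group_add \<Rightarrow> 'a"
  shows "(\<forall>mu alpha. jordan_algebra scale mu \<longrightarrow> algebra_morphism scale mu scale mu alpha \<longrightarrow>
            hom_jordan_algebra scale (induced_mult mu alpha) alpha) \<and>
         (\<forall>mu alpha. hom_jordan_algebra scale mu alpha \<longrightarrow>
            (\<forall>n. hom_jordan_algebra scale (derived_mult n mu alpha) (derived_twist n alpha)))"
proof (intro conjI allI impI)
  fix mu alpha
  assume "jordan_algebra scale mu" and "algebra_morphism scale mu scale mu alpha"
  then show "hom_jordan_algebra scale (induced_mult mu alpha) alpha"
    using hom_jordan_algebra_twist[OF jordan_algebra_imp_hom_jordan_algebra_id] by fastforce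
next
  fix mu alpha and n :: nat
  assume hom_jordan: "hom_jordan_algebra scale mu alpha"
  interpret hom_jordan_algebra scale mu alpha by fact
  let ?\<beta> = "alpha ^^ (2 ^ n - 1)"
  have "hom_jordan_algebra scale (induced_mult mu ?\<beta>) (?\<beta> \<circ> alpha)"
    using hom_jordan algebra_morphism_funpow[OF algebra_morphism_axioms]
    by (rule hom_jordan_algebra_twist) (simp add: fun_eq_iff funpow_swap1)
  moreover have "induced_mult mu ?\<beta> = derived_mult n mu alpha"
    by (simp add: fun_eq_iff induced_mult_def derived_mult_def)
  moreover have "?\<beta> \<circ> alpha = derived_twist n alpha"
  proof -
    have "?\<beta> \<circ> alpha = alpha ^^ Suc (2 ^ n - 1)"
      by (rule funpow_Suc_right[symmetric])
    then show ?thesis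
      by (simp add: derived_twist_def)
  qed
  ultimately show "hom_jordan_algebra scale (derived_mult n mu alpha) (derived_twist n alpha)"
    by simp
qed

end
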